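(* Let $\mathcal{G}=(A,B;S,T)$ be a constrained bi-matrix game with $A,B\in\mathbb{R}^{m\times n}$, and let $(x,y)\in\mathbb{R}^m\times\mathbb{R}^n$. The following are equivalent: (i) $(x,y)\in\operatorname{extNash}(\mathcal{G})$; (ii) $\begin{pmatrix}y\\ y^{\top}A^{\top}x\end{pmatrix}$ is a vertex of $\operatorname{epi}\eta$ and $\begin{pmatrix}x\\ x^{\top}By\end{pmatrix}$ is a vertex of $\operatorname{epi}\xi$.
   Context: A constrained bi-matrix game $\mathcal{G}=(A,B;S,T)$ consists of $A,B\in\mathbb{R}^{m\times n}$ and nonempty convex polytopes $S\subseteq\mathbb{R}^m$, $T\subseteq\mathbb{R}^n$. $\operatorname{Nash}(\mathcal{G})$ is the set of Nash equilibria: pairs $(x,y)\in S\times T$ with $x\in\arg\max_{x'\in S}y^{\top}A^{\top}x'$ and $y\in\arg\max_{y'\in T}x^{\top}By'$. The payoff function is $p(x,y)=(y^{\top}A^{\top}x,\ x^{\top}By)$. A Nash equilibrium $(x,y)$ is extremal if $(x,y,p(x,y))$ cannot be expressed as a proper convex combination of $(x^i,y^i,p(x^i,y^i))$ for finitely many Nash equilibria $(x^i,y^i)$ (proper: a convex combination, with positive coefficients, of at least two distinct points); $\operatorname{extNash}(\mathcal{G})$ is the set of extremal Nash equilibria. The optimal value functions are $\eta:\mathbb{R}^n\to\mathbb{R}\cup\{\infty\}$, $\eta(y)=\max_{x\in S}y^{\top}A^{\top}x$ if $y\in T$ and $\infty$ otherwise, and $\xi:\mathbb{R}^m\to\mathbb{R}\cup\{\infty\}$,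 $\xi(x)=\max_{y\in T}x^{\top}By$ if $x\in S$ and $\infty$ otherwise. $\operatorname{epi}$ denotes the epigraph. A vertex of a convex polyhedron $P$ is a point of $P$ that is not a strict convex combination of two distinct points of $P$. *)

theory Defs
  imports "HOL-Analysis.Analysis"
begin

text \<open>A constrained bi-matrix game is given by two matrices with rows indexed by \<open>'m\<close> and
  columns by \<open>'n\<close>, and strategy sets \<open>S\<close>, \<open>T\<close>. The requirement that \<open>S\<close> and \<open>T\<close> are nonempty
  polytopes is not built into the definitions.\<close>

definition payoff ::
  "real^'n^'m \<Rightarrow> real^'n^'m \<Rightarrow> real^'m \<Rightarrow> real^'n \<Rightarrow> real \<times> real" where
  "payoff A B x y = (y \<bullet> (transpose A *v x), x \<bullet> (B *v y))"

definition Nash ::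
  "real^'n^'m \<Rightarrow> real^'n^'m \<Rightarrow> (real^'m) set \<Rightarrow> (real^'n) set \<Rightarrow> ((real^'m) \<times> (real^'n)) set" where
  "Nash A B S T = {(x, y) \<in> S \<times> T.
     is_arg_max (\<lambda>x'. y \<bullet> (transpose A *v x')) (\<lambda>x'. x' \<in> S) x \<and>
     is_arg_max (\<lambda>y'. x \<bullet> (B *v y')) (\<lambda>y'. y' \<in> T) y}"

definition proper_convex_combination :: "'a::real_vector \<Rightarrow> 'a set \<Rightarrow> bool" where
  "proper_convex_combination z P \<longleftrightarrow>
     (\<exists>F c. finite F \<and> F \<subseteq> P \<and> card F \<ge> 2 \<and> (\<forall>v\<in>F. c v > 0) \<and> sum c F = (1::real) \<and>
            z = (\<Sum>v\<in>F. c v *\<^sub>R v))"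

definition extNash ::
  "real^'n^'m \<Rightarrow> real^'n^'m \<Rightarrow> (real^'m) set \<Rightarrow> (real^'n) set \<Rightarrow> ((real^'m) \<times> (real^'n)) set" where
  "extNash A B S T = {(x, y) \<in> Nash A B S T.
     \<not> proper_convex_combination (x, y, payoff A B x y)
         {(x', y', payoff A B x' y') | x' y'. (x', y') \<in> Nash A B S T}}"

text \<open>The maxima in the optimal value functions are written as suprema in \<open>ereal\<close>; for nonempty
  polytopes they are finite and attained, see \<open>eta_eq_max\<close> and \<open>xi_eq_max\<close> below.\<close>

definition eta :: "real^'n^'m \<Rightarrow> (real^'m) set \<Rightarrow> (real^'n) set \<Rightarrow> real^'n \<Rightarrow> ereal" where
  "eta A S T y = (if y \<in> T then SUP x\<in>S. ereal (y \<bullet> (transpose A *v x)) else \<infinity>)"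

definition xi :: "real^'n^'m \<Rightarrow> (real^'m) set \<Rightarrow> (real^'n) set \<Rightarrow> real^'m \<Rightarrow> ereal" where
  "xi B S T x = (if x \<in> S then SUP y\<in>T. ereal (x \<bullet> (B *v y)) else \<infinity>)"

text \<open>The library's \<open>epigraph\<close> covers real-valued functions only.\<close>

definition epi :: "('a \<Rightarrow> ereal) \<Rightarrow> ('a \<times> real) set" where
  "epi f = {(v, t). f v \<le> ereal t}"

lemma SUP_ereal_linear_attained:
  fixes f :: "'a::euclidean_space \<Rightarrow> real"
  assumes "polytope P" "P \<noteq> {}" "linear f"
  shows "\<exists>v. is_arg_max f (\<lambda>v. v \<in> P) v \<and> (SUP v\<in>P. ereal (f v)) = ereal (f v)"
proof -
  have "continuous_on P f"
    using assms(3) by (simp add: linear_continuous_on linear_conv_bounded_linear)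
  then obtain v where v: "v \<in> P" "\<forall>u\<in>P. f u \<le> f v"
    using continuous_attains_sup[OF polytope_imp_compact[OF assms(1)] assms(2)] by blast
  then have "is_arg_max f (\<lambda>v. v \<in> P) v"
    by (auto simp: is_arg_max_def not_less)
  moreover have "(SUP v\<in>P. ereal (f v)) = ereal (f v)"
    using v by (intro antisym SUP_least SUP_upper) auto
  ultimately show ?thesis by blast
qed

lemma eta_eq_max:
  assumes "polytope S" "S \<noteq> {}" "y \<in> T"
  shows "\<exists>x. is_arg_max (\<lambda>x'. y \<bullet> (transpose A *v x')) (\<lambda>x'. x' \<in> S) x \<and>
             eta A S T y = ereal (y \<bullet> (transpose A *v x))"
proof -
  have "linear (\<lambda>x'. y \<bullet> (transpose A *v x'))"
    by (rule linearI) (simp_all add: matrix_vector_right_distrib inner_add_right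
                         matrix_vector_mult_scaleR)
  from SUP_ereal_linear_attained[OF assms(1,2) this] assms(3) show ?thesis
    by (simp add: eta_def)
qed

lemma xi_eq_max:
  assumes "polytope T" "T \<noteq> {}" "x \<in> S"
  shows "\<exists>y. is_arg_max (\<lambda>y'. x \<bullet> (B *v y')) (\<lambda>y'. y' \<in> T) y \<and>
             xi B S T x = ereal (x \<bullet> (B *v y))"
proof -
  have "linear (\<lambda>y'. x \<bullet> (B *v y'))"
    by (rule linearI) (simp_all add: matrix_vector_right_distrib inner_add_right
                         matrix_vector_mult_scaleR)
  from SUP_ereal_linear_attained[OF assms(1,2) this] assms(3) show ?thesis
    by (simp add: xi_def)
qed

end

theory Submission
  imports Defs
begin

text \<open>Points of \<open>epi \<eta>\<close> on its graph that lie strictly inside a segment of \<open>epi \<eta>\<close> have both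
  endpoints on the graph; linearity in \<open>y\<close> for fixed \<open>x\<close> then makes both endpoints equilibria with
  the same \<open>x\<close>, so \<open>(x, y)\<close> is not extremal. Conversely, a convex combination of equilibria
  together with their payoffs projects to convex combinations in both epigraphs, and vertices only
  admit trivial ones.\<close>

lemma in_epi_eta_iff:
  "(y, t) \<in> epi (eta A S T) \<longleftrightarrow> y \<in> T \<and> (\<forall>x\<in>S. y \<bullet> (transpose A *v x) \<le> t)"
  by (simp add: epi_def eta_def SUP_le_iff)

text \<open>Exchanging the two players turns one value function into the other, so every fact about
  \<eta> also serves \<xi>.\<close>

lemma xi_eq_eta_transpose: "xi B S T = eta (transpose B) T S"
  by (simp add: fun_eq_iff xi_def eta_def)

lemma Nash_iff:
  "(x, y) \<in> Nash A B S T \<longleftrightarrow>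
    x \<in> S \<and> y \<in> T \<and> (\<forall>x'\<in>S. y \<bullet> (transpose A *v x') \<le> y \<bullet> (transpose A *v x)) \<and>
    (\<forall>y'\<in>T. x \<bullet> (B *v y') \<le> x \<bullet> (B *v y))"
  by (auto simp: Nash_def is_arg_max_def not_less)

lemma Nash_swap: "(x, y) \<in> Nash A B S T \<longleftrightarrow> (y, x) \<in> Nash (transpose B) (transpose A) T S"
  by (auto simp: Nash_iff)

text \<open>The epigraph over \<open>y\<close> says that no strategy in \<open>S\<close> earns more
  against \<open>y\<close> than \<open>x\<close> does, which makes \<open>x\<close> a best response
  once \<open>x \<in> S\<close>; that membership comes from the other epigraph, and
  symmetrically.\<close>

lemma Nash_iff_epi:
  "(x, y) \<in> Nash A B S T \<longleftrightarrow>
    (y, y \<bullet> (transpose A *v x)) \<in> epi (eta A S T) \<and> (x, x \<bullet> (B *v y)) \<in> epi (xi B S T)"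
  by (auto simp: Nash_iff xi_eq_eta_transpose in_epi_eta_iff)

lemma convex_epi_eta:
  assumes "convex T"
  shows "convex (epi (eta A S T))"
proof (rule convexI, clarify)
  fix y1 t1 y2 t2 and u v :: real
  assume *: "(y1, t1) \<in> epi (eta A S T)" "(y2, t2) \<in> epi (eta A S T)"
    "0 \<le> u" "0 \<le> v" "u + v = 1"
  then have "u *\<^sub>R y1 + v *\<^sub>R y2 \<in> T"
    using assms by (auto simp: in_epi_eta_iff convex_def)
  moreover have "(u *\<^sub>R y1 + v *\<^sub>R y2) \<bullet> (transpose A *v x) \<le> u * t1 + v * t2"
    if "x \<in> S" for x
    using * that by (auto simp: in_epi_eta_iff inner_add_left intro!: add_mono mult_left_mono)
  ultimately show "u *\<^sub>R (y1, t1) + v *\<^sub>R (y2, t2) \<in> epi (eta A S T)"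
    by (simp add: in_epi_eta_iff)
qed

text \<open>The slacks \<open>t1 - a1\<close> and \<open>t2 - a2\<close> are nonnegative and their
  sum with positive weights is zero, so both vanish.\<close>

lemma convex_combination_eq_bounds:
  fixes u a1 a2 t1 t2 :: real
  assumes "0 < u" "u < 1" "a1 \<le> t1" "a2 \<le> t2"
    and "(1 - u) * a1 + u * a2 = (1 - u) * t1 + u * t2"
  shows "a1 = t1" "a2 = t2"
proof -
  have "(1 - u) * (t1 - a1) + u * (t2 - a2) = 0"
    using assms(5) by (simp add: algebra_simps)
  moreover have "0 \<le> (1 - u) * (t1 - a1)" "0 \<le> u * (t2 - a2)"
    using assms by auto
  ultimately have "(1 - u) * (t1 - a1) = 0" "u * (t2 - a2) = 0"
    by linarith+
  then show "a1 = t1" "a2 = t2"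
    using assms by auto
qed

lemma proper_convex_combination_segment:
  assumes "p \<in> P" "q \<in> P" "p \<noteq> q" "0 < u" "u < 1"
  shows "proper_convex_combination ((1 - u) *\<^sub>R p + u *\<^sub>R q) P"
  unfolding proper_convex_combination_def
  using assms by (intro exI[of _ "{p, q}"] exI[of _ "\<lambda>v. if v = p then 1 - u else u"]) auto

text \<open>Split off the summand \<open>j\<close> and renormalise the rest to a point
  \<open>w\<close> of \<open>C\<close>. Then \<open>z\<close> lies strictly between
  \<open>f j\<close> and \<open>w\<close>, so extremality forces \<open>f j = w = z\<close>. The sum
  runs over indices, since distinct indices may have the same image under \<open>f\<close>, as
  happens for the projections used later.\<close>

lemma extreme_point_of_convex_sum:
  fixes f :: "'b \<Rightarrow> 'a::real_vector"
  assumes "z extreme_point_of C" "convex C" "finite F"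
    and pos: "\<And>i. i \<in> F \<Longrightarrow> c i > 0" and "sum c F = 1"
    and f: "\<And>i. i \<in> F \<Longrightarrow> f i \<in> C" and z: "z = (\<Sum>i\<in>F. c i *\<^sub>R f i)"
    and j: "j \<in> F"
  shows "f j = z"
proof -
  define d where "d = sum c (F - {j})"
  define w where "w = (\<Sum>i\<in>F - {j}. (c i / d) *\<^sub>R f i)"
  have d: "d = 1 - c j"
    using assms(3,5) j by (simp add: d_def sum_diff1)
  have z': "z = c j *\<^sub>R f j + (\<Sum>i\<in>F - {j}. c i *\<^sub>R f i)"
    unfolding z by (rule sum.remove[OF assms(3) j])
  show ?thesis
  proof (cases "F - {j} = {}")
    \<comment> \<open>The sum defining \<open>d\<close> is empty, so \<open>d = 0\<close> and
      \<open>c j = 1\<close>.\<close>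
    case True
    then show ?thesis
      using z' d unfolding d_def True by simp
  next
    case False
    then have "d > 0"
      unfolding d_def using assms(3) pos by (intro sum_pos) auto
    then have "w \<in> C"
      unfolding w_def using assms(2,3) pos f
      by (intro convex_sum) (auto simp: sum_divide_distrib[symmetric] d_def[symmetric] less_imp_le)
    have zw: "z = (1 - d) *\<^sub>R f j + d *\<^sub>R w"
      using z' d \<open>d > 0\<close> by (simp add: w_def scaleR_right.sum)
    moreover have "d < 1"
      using pos[OF j] d by simp
    moreover have "z \<notin> open_segment (f j) w"
      using assms(1) f[OF j] \<open>w \<in> C\<close> by (simp add: extreme_point_of_def)
    ultimately have "f j = w"
      using \<open>d > 0\<close> by (auto simp: in_segment)
    then show ?thesis
      using zw by (simp add: scaleR_left_diff_distrib)
  qed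
qed

lemma Nash_segment_if_not_extreme:
  assumes N: "(x, y) \<in> Nash A B S T"
    and "\<not> (y, y \<bullet> (transpose A *v x)) extreme_point_of (epi (eta A S T))"
  obtains y1 y2 u where "y1 \<noteq> y2" "0 < u" "u < 1" "y = (1 - u) *\<^sub>R y1 + u *\<^sub>R y2"
    "(x, y1) \<in> Nash A B S T" "(x, y2) \<in> Nash A B S T"
proof -
  let ?a = "\<lambda>y. y \<bullet> (transpose A *v x)" and ?b = "\<lambda>y. x \<bullet> (B *v y)"
  have "(y, ?a y) \<in> epi (eta A S T)"
    using N by (simp add: Nash_iff_epi)
  with assms(2) obtain y1 t1 y2 t2 where
    e: "(y1, t1) \<in> epi (eta A S T)" "(y2, t2) \<in> epi (eta A S T)"
    and "(y, ?a y) \<in> open_segment (y1, t1) (y2, t2)"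
    by (auto simp: extreme_point_of_def)
  then obtain u where ne: "(y1, t1) \<noteq> (y2, t2)" and u: "0 < u" "u < 1"
    and y: "y = (1 - u) *\<^sub>R y1 + u *\<^sub>R y2" and t: "?a y = (1 - u) * t1 + u * t2"
    by (auto simp: in_segment)
  have x: "x \<in> S" and b: "\<And>y'. y' \<in> T \<Longrightarrow> ?b y' \<le> ?b y"
    using N by (auto simp: Nash_iff)
  have T: "y1 \<in> T" "y2 \<in> T"
    using e by (auto simp: in_epi_eta_iff)
  \<comment> \<open>The heights bound all payoffs against \<open>y1\<close> and \<open>y2\<close>,
    in particular those of \<open>x\<close>. Equality on average forces equality at both ends, so
    \<open>x\<close> is a best response to both.\<close>
  have "?a y1 \<le> t1" "?a y2 \<le> t2"
    using e x by (auto simp: in_epi_eta_iff)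
  moreover have "(1 - u) * ?a y1 + u * ?a y2 = (1 - u) * t1 + u * t2"
    using t by (simp add: y inner_add_left)
  ultimately have a: "?a y1 = t1" "?a y2 = t2"
    using convex_combination_eq_bounds u by blast+
  \<comment> \<open>Neither endpoint can beat the best response \<open>y\<close> to
    \<open>x\<close>, but their values average to \<open>?b y\<close>; hence both endpoints are best
    responses too.\<close>
  have "(1 - u) * ?b y1 + u * ?b y2 = ?b y"
    by (simp add: y matrix_vector_right_distrib inner_add_right matrix_vector_mult_scaleR)
  also have "\<dots> = (1 - u) * ?b y + u * ?b y"
    by (simp add: algebra_simps)
  finally have "?b y1 = ?b y" "?b y2 = ?b y"
    using convex_combination_eq_bounds[OF u b b] T by blast+
  then have "(x, y1) \<in> Nash A B S T" "(x, y2) \<in> Nash A B S T"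
    using x T a e b by (auto simp: Nash_iff in_epi_eta_iff)
  \<comment> \<open>The heights are determined by the base points, so the endpoints cannot differ in
    height alone.\<close>
  moreover have "y1 \<noteq> y2"
    using ne a by auto
  ultimately show thesis
    using that u y by blast
qed

theorem proposition3p5:
  fixes A B :: "real^'n^'m"
    and S :: "(real^'m) set" and T :: "(real^'n) set"
    and x :: "real^'m" and y :: "real^'n"
  assumes "polytope S" and "S \<noteq> {}"
    and "polytope T" and "T \<noteq> {}"
  shows "(x, y) \<in> extNash A B S T \<longleftrightarrow>
    (y, y \<bullet> (transpose A *v x)) extreme_point_of (epi (eta A S T)) \<and>
    (x, x \<bullet> (B *v y)) extreme_point_of (epi (xi B S T))"
    (is "?lhs \<longleftrightarrow> ?Y \<and> ?X")
proof
  let ?g = "\<lambda>x y. (x, y, payoff A B x y)"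
  let ?P = "{?g x' y' | x' y'. (x', y') \<in> Nash A B S T}"
  {
    assume ?lhs
    then have N: "(x, y) \<in> Nash A B S T"
      and no: "\<not> proper_convex_combination (?g x y) ?P"
      by (auto simp: extNash_def)
    have ?Y
    proof (rule ccontr)
      assume "\<not> ?Y"
      from Nash_segment_if_not_extreme[OF N this] obtain y1 y2 u
        where *: "y1 \<noteq> y2" "0 < u" "u < 1" "y = (1 - u) *\<^sub>R y1 + u *\<^sub>R y2"
          "(x, y1) \<in> Nash A B S T" "(x, y2) \<in> Nash A B S T" .
      have "proper_convex_combination ((1 - u) *\<^sub>R ?g x y1 + u *\<^sub>R ?g x y2) ?P"
        using * by (intro proper_convex_combination_segment) auto
      \<comment> \<open>With \<open>x\<close> fixed, both payoffs are linear in \<open>y\<close>, so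
        the payoff components combine correctly as well.\<close>
      moreover have "(1 - u) *\<^sub>R ?g x y1 + u *\<^sub>R ?g x y2 = ?g x y"
        by (simp add: *(4) payoff_def algebra_simps matrix_vector_right_distrib
            matrix_vector_mult_diff_distrib matrix_vector_mult_scaleR)
      ultimately show False
        using no by simp
    qed
    moreover have ?X
    proof (rule ccontr)
      assume "\<not> ?X"
      \<comment> \<open>The double transpose puts the claim into the form of the segment lemma for
        the game with the players exchanged.\<close>
      then have "\<not> (x, x \<bullet> (transpose (transpose B) *v y)) extreme_point_of
          (epi (eta (transpose B) T S))"
        by (simp add: xi_eq_eta_transpose)
      from Nash_segment_if_not_extreme[OF N[unfolded Nash_swap[of x]] this] obtain x1 x2 u
        where *: "x1 \<noteq> x2" "0 < u" "u < 1" "x = (1 - u) *\<^sub>R x1 + u *\<^sub>R x2"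
          "(x1, y) \<in> Nash A B S T" "(x2, y) \<in> Nash A B S T"
        unfolding Nash_swap[symmetric] .
      have "proper_convex_combination ((1 - u) *\<^sub>R ?g x1 y + u *\<^sub>R ?g x2 y) ?P"
        using * by (intro proper_convex_combination_segment) auto
      moreover have "(1 - u) *\<^sub>R ?g x1 y + u *\<^sub>R ?g x2 y = ?g x y"
        by (simp add: *(4) payoff_def algebra_simps matrix_vector_right_distrib
            matrix_vector_mult_diff_distrib matrix_vector_mult_scaleR)
      ultimately show False
        using no by simp
    qed
    ultimately show "?Y \<and> ?X" ..
  }
  assume YX: "?Y \<and> ?X"
  have convex: "convex (epi (eta A S T))" "convex (epi (xi B S T))"
    using assms by (simp_all add: xi_eq_eta_transpose convex_epi_eta polytope_imp_convex)
  have "\<not> proper_convex_combination (?g x y) ?P"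
  proof
    assume "proper_convex_combination (?g x y) ?P"
    then obtain F c where F: "finite F" "F \<subseteq> ?P" "card F \<ge> 2" "\<And>v. v \<in> F \<Longrightarrow> c v > 0"
        "sum c F = 1" and eq: "?g x y = (\<Sum>v\<in>F. c v *\<^sub>R v)"
      unfolding proper_convex_combination_def by blast
    \<comment> \<open>These linear projections pick each player's epigraph point out of a tuple.
      Together they retain all four components, so a tuple is determined by its two images.\<close>
    let ?fY = "\<lambda>v::(real^'m) \<times> (real^'n) \<times> real \<times> real. (fst (snd v), fst (snd (snd v)))"
    let ?fX = "\<lambda>v::(real^'m) \<times> (real^'n) \<times> real \<times> real. (fst v, snd (snd (snd v)))"
    have linear: "linear ?fY" "linear ?fX"
      by (auto intro!: linearI)
    have sums: "(y, y \<bullet> (transpose A *v x)) = (\<Sum>v\<in>F. c v *\<^sub>R ?fY v)"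
      "(x, x \<bullet> (B *v y)) = (\<Sum>v\<in>F. c v *\<^sub>R ?fX v)"
      using arg_cong[OF eq, of ?fY] arg_cong[OF eq, of ?fX]
      by (simp_all only: linear_sum[OF linear(1)] linear_sum[OF linear(2)]
          linear_scale[OF linear(1)] linear_scale[OF linear(2)])
        (simp_all add: payoff_def)
    have epi: "?fY v \<in> epi (eta A S T)" "?fX v \<in> epi (xi B S T)" if "v \<in> F" for v
      using that F(2) by (auto simp: payoff_def Nash_iff_epi)
    have "v = ?g x y" if "v \<in> F" for v
    proof -
      have "?fY v = (y, y \<bullet> (transpose A *v x))"
        using YX convex(1) F(1,4,5) epi(1) sums(1) that by (rule extreme_point_of_convex_sum[OF conjunct1])
      moreover have "?fX v = (x, x \<bullet> (B *v y))"
        using YX convex(2) F(1,4,5) epi(2) sums(2) that by (rule extreme_point_of_convex_sum[OF conjunct2])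
      ultimately show ?thesis
        by (auto simp: payoff_def prod_eq_iff)
    qed
    \<comment> \<open>Every point of \<open>F\<close> coincides with the given one, so
      \<open>F\<close> cannot contain two distinct points.\<close>
    then have "card F \<le> card {?g x y}"
      by (intro card_mono) auto
    with F(3) show False
      by simp
  qed
  \<comment> \<open>An extreme point belongs to its set, and the two epigraph memberships together
    characterise an equilibrium.\<close>
  moreover have "(x, y) \<in> Nash A B S T"
    using YX by (simp add: Nash_iff_epi extreme_point_of_def)
  ultimately show ?lhs
    by (simp add: extNash_def)
qed

end
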